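(* Let $n,k\ge 1$ be integers and suppose that a set of $p\ge k(n-1)+1$ employees satisfies the following conditions. (1) For any partition of $k$ days into $n$ shifts each, every employee finds at least one selection of $k$ shifts, one in each day, acceptable. (2) The employees prefer empty shifts, if available. (3) The employees' preference sets are closed. Then there exists a partition $x$ of the $k$ days into $n$ shifts each for which some subset of at most $n(1+\ln k)$ employees covers all the $kn$ shifts. Moreover, if $k=2$, there exist a partition $x$ and a subset of $n$ employees that covers all the $2n$ shifts.
   Context: $[n]=\{1,\dots,n\}$ and $\Delta_{n-1}=\{y\in\mathbb{R}^n_{\ge 0}:\sum_{i} y_i=1\}$. A partition of $k$ days into $n$ shifts each is a point $x=(x_1,\dots,x_k)\in(\Delta_{n-1})^k$, where the $i$-th coordinate of $x_j$ is the length of shift $i$ on day $j$; a shift is empty if its length is $0$. A $k$-shift selection is a tuple $s=(s_1,\dots,s_k)\in[n]^k$ (shift $s_j$ is chosen on day $j$). Each employee $e$ has preferences given by a set $C^e_s\subseteq(\Delta_{n-1})^k$ for each $s\in[n]^k$: $s$ is acceptable to $e$ in the partition $x$ iff $x\in C^e_s$; several selections may be acceptable in the same partition. Closed preference sets means that every $C^e_s$ is closed. "Employees prefer empty shifts, if available" means: if $s$ is acceptable to $e$ in $x$ and day $j$ has at least one empty shift in $x$, then $s_j$ is an empty shift of day $j$. Employees are indifferent between several empty shifts on the same day: if $s$ is acceptable to $e$ in $x$ and $s_j$ is an empty shift of day $j$, then replacing $s_j$ by any other empty shift of day $j$ again gives a selection acceptable to $e$ in $x$. A set $N$ of employees covers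 all the shifts in the partition $x$ if one can choose for each $e\in N$ a selection $s^e\in[n]^k$ acceptable to $e$ in $x$ so that for every $i\in[n]$ and $j\in[k]$ there is $e\in N$ with $s^e_j=i$. *)

theory Defs
  imports "HOL-Analysis.Analysis"
begin

text \<open>
  The index types \<open>'n\<close> (shifts) and \<open>'k\<close> (days) stand for $[n]$ and $[k]$, with
  \<open>n = CARD('n)\<close> and \<open>k = CARD('k)\<close>. For \<open>x :: real^'n^'k\<close>, the number \<open>x $ j $ i\<close> is the
  length of shift \<open>i\<close> on day \<open>j\<close>.
\<close>

definition simplex_points :: "(real^'n) set" where
  "simplex_points = {y. (\<forall>i. 0 \<le> y $ i) \<and> (\<Sum>i\<in>UNIV. y $ i) = 1}"

definition day_partitions :: "(real^'n^'k) set" where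
  "day_partitions = {x. \<forall>j. x $ j \<in> simplex_points}"

type_synonym ('n, 'k) selection = "'k \<Rightarrow> 'n"

text \<open>A selection \<open>s\<close> is acceptable in the partition \<open>x\<close> iff \<open>x \<in> C s\<close>.\<close>

type_synonym ('n, 'k) preferences = "('n, 'k) selection \<Rightarrow> (real^'n^'k) set"

definition empty_shift :: "real^'n^'k \<Rightarrow> 'k \<Rightarrow> 'n \<Rightarrow> bool" where
  "empty_shift x j i \<longleftrightarrow> x $ j $ i = 0"

definition always_accepts_some :: "('n::finite, 'k::finite) preferences \<Rightarrow> bool" where
  "always_accepts_some C \<longleftrightarrow> (\<forall>x\<in>day_partitions. \<exists>s. x \<in> C s)"

definition prefers_empty_shifts :: "('n::finite, 'k::finite) preferences \<Rightarrow> bool" where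
  "prefers_empty_shifts C \<longleftrightarrow>
     (\<forall>s x j. x \<in> C s \<and> (\<exists>i. empty_shift x j i) \<longrightarrow> empty_shift x j (s j))"

definition indifferent_between_empty_shifts :: "('n::finite, 'k::finite) preferences \<Rightarrow> bool" where
  "indifferent_between_empty_shifts C \<longleftrightarrow>
     (\<forall>s x j i. x \<in> C s \<and> empty_shift x j (s j) \<and> empty_shift x j i \<longrightarrow> x \<in> C (s(j := i)))"

definition covers_all_shifts ::
  "('e \<Rightarrow> ('n::finite, 'k::finite) preferences) \<Rightarrow> 'e set \<Rightarrow> real^'n^'k \<Rightarrow> bool" where
  "covers_all_shifts C N x \<longleftrightarrow>
     (\<exists>sel :: 'e \<Rightarrow> ('n, 'k) selection.
        (\<forall>e\<in>N. x \<in> C e (sel e)) \<and> (\<forall>i j. \<exists>e\<in>N. sel e j = i))"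

end

theory Submission imports Defs
begin

text \<open>
  Encode a selection \<open>s\<close> as the vertex of the product of \<open>k\<close> simplices that puts mass 1 on
  shift \<open>s j\<close> of day \<open>j\<close>. The heart of the proof is a colourful covering result: there are a
  partition \<open>x\<close> and, for each of \<open>k(n - 1) + 1\<close> employees, a selection acceptable in \<open>x\<close>, such
  that the barycentre (every shift of every day has length \<open>1/n\<close>) is a convex combination of the
  chosen vertices. In other words the chosen selections, weighted suitably, cover every shift of
  every day with total weight 1 (lemma \<open>fractionally_covered_partition\<close>).

  This number of employees is one more than the dimension \<open>d\<close> of the polytope of partitions, and
  this enters through covering dimension: the polytope has arbitrarily fine covers by \<open>d + 1\<close>
  families, each consisting of pairwise disjoint small cells. Giving each employee one family,
  let the employee choose an acceptable selection at a sample point of each cell of that family,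
  and interpolate the chosen vertices by a partition of unity. The value \<open>F x\<close> of the resulting
  continuous map is a convex combination of vertices chosen by distinct employees at
  points close to \<open>x\<close>. By Brouwer's theorem \<open>F\<close> solves a variational inequality:
  \<open>F x \<bullet> (y - x) \<le> 0\<close> for some \<open>x\<close> and all \<open>y\<close>. As the mesh tends to 0, compactness and the
  closedness of the preference sets give a point \<open>x\<close> at which all the chosen selections are
  acceptable, and a convex combination \<open>f\<close> of their vertices that satisfies the inequality at \<open>x\<close>
  (lemma \<open>colourful_variational_inequality\<close>).

  The inequality says that \<open>f\<close> is maximal, within each day, on the nonempty shifts of \<open>x\<close>. If some
  day had an empty shift, then the employees would choose only empty shifts on that day, so \<open>f\<close>
  would vanish on the nonempty ones and hence be nonpositive throughout, although its entries add
  up to 1. Hence no shift is empty, \<open>f\<close> is constant on each day, and \<open>f\<close> is the barycentre.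

  It remains to pass from a fractional cover to a set of employees. The weights, normalised to
  cover each shift with weight 1, have total \<open>n\<close>, and each selection contains \<open>k\<close> of the \<open>kn\<close>
  pairs of a day and a shift, so the greedy cover has at most \<open>n\<close> times the \<open>k\<close>-th harmonic number
  of members, and that number is at most \<open>1 + ln k\<close> (lemma \<open>greedy_cover\<close>). For \<open>k = 2\<close> the
  selections are the edges of a bipartite multigraph with a fractional perfect matching, and
  Hall's theorem gives a perfect matching (lemma \<open>perfect_matching_of_fractional\<close>).
\<close>

section \<open>Small cells in one more colour than the dimension\<close>

text \<open>
  An integer vector \<open>c\<close> stands for a face of the tessellation of \<open>\<real>\<^sup>I\<close> by cubes of side 2 with
  vertices in the even lattice: coordinate \<open>i\<close> is fixed to \<open>c i\<close> if \<open>c i\<close> is even and ranges over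
  the interval of radius 1 around \<open>c i\<close> if \<open>c i\<close> is odd. Where the first product is positive,
  \<open>\<bar>z i - c i\<bar>\<close> (\<open>c i\<close> even) and \<open>1 - \<bar>z j - c j\<bar>\<close> (\<open>c j\<close> odd) are the distances of \<open>z i\<close> and \<open>z j\<close>
  to the nearest even integer. Inside this box the weight is thus positive where every coordinate
  fixed by the face is closer to the even integers than every coordinate left free; this is a
  neighbourhood of the open face that avoids the neighbourhoods of all other faces of the same dimension.
\<close>

definition cell_weight :: "'i set \<Rightarrow> ('i \<Rightarrow> int) \<Rightarrow> ('i \<Rightarrow> real) \<Rightarrow> real" where
  "cell_weight I c z = (\<Prod>i\<in>I. max 0 (1 - \<bar>z i - c i\<bar>)) *
     (\<Prod>i\<in>{i\<in>I. even (c i)}. \<Prod>j\<in>{j\<in>I. odd (c j)}. max 0 (1 - \<bar>z i - c i\<bar> - \<bar>z j - c j\<bar>))"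

lemma cell_weight_nonneg: "0 \<le> cell_weight I c z"
  unfolding cell_weight_def by (intro mult_nonneg_nonneg prod_nonneg) auto

lemma cell_weight_pos_iff:
  assumes "finite I"
  shows "0 < cell_weight I c z \<longleftrightarrow> (\<forall>i\<in>I. \<bar>z i - c i\<bar> < 1) \<and>
    (\<forall>i\<in>I. \<forall>j\<in>I. even (c i) \<longrightarrow> odd (c j) \<longrightarrow> \<bar>z i - c i\<bar> + \<bar>z j - c j\<bar> < 1)" (is "_ \<longleftrightarrow> ?R")
proof
  assume ?R
  then show "0 < cell_weight I c z"
    unfolding cell_weight_def by (intro mult_pos_pos prod_pos) (auto simp: less_max_iff_disj algebra_simps)
next
  assume "0 < cell_weight I c z"
  then have nz: "(\<Prod>i\<in>I. max 0 (1 - \<bar>z i - c i\<bar>)) \<noteq> 0"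
    "(\<Prod>i\<in>{i\<in>I. even (c i)}. \<Prod>j\<in>{j\<in>I. odd (c j)}. max 0 (1 - \<bar>z i - c i\<bar> - \<bar>z j - c j\<bar>)) \<noteq> 0"
    unfolding cell_weight_def by auto
  show ?R
  proof (intro conjI ballI impI)
    fix i assume "i \<in> I"
    then have "max 0 (1 - \<bar>z i - c i\<bar>) \<noteq> 0"
      using nz(1) assms by (subst (asm) prod_zero_iff) auto
    then show "\<bar>z i - c i\<bar> < 1" by (auto simp: max_def split: if_splits)
  next
    fix i j assume "i \<in> I" "j \<in> I" "even (c i)" "odd (c j)"
    then have "(\<Prod>j\<in>{j\<in>I. odd (c j)}. max 0 (1 - \<bar>z i - c i\<bar> - \<bar>z j - c j\<bar>)) \<noteq> 0"
      using nz(2) assms by (subst (asm) prod_zero_iff) auto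
    then have "max 0 (1 - \<bar>z i - c i\<bar> - \<bar>z j - c j\<bar>) \<noteq> 0"
      using assms \<open>j \<in> I\<close> \<open>odd (c j)\<close> by (subst (asm) prod_zero_iff) auto
    then show "\<bar>z i - c i\<bar> + \<bar>z j - c j\<bar> < 1" by (auto simp: max_def split: if_splits)
  qed
qed

lemma continuous_on_cell_weight:
  assumes "\<And>i. i \<in> I \<Longrightarrow> continuous_on K (\<lambda>x. z x i)"
  shows "continuous_on K (\<lambda>x. cell_weight I c (z x))"
  unfolding cell_weight_def using assms
  by (intro continuous_intros continuous_on_prod) auto

lemma int_dist_ge_1:
  fixes a b :: int and t :: real
  assumes "a \<noteq> b"
  shows "1 \<le> \<bar>t - a\<bar> + \<bar>t - b\<bar>"
proof -
  have "1 \<le> \<bar>a - b\<bar>" using assms by linarith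
  then have "1 \<le> \<bar>real_of_int a - real_of_int b\<bar>"
    by (metis of_int_1_le_iff of_int_abs of_int_diff)
  then show ?thesis by linarith
qed

text \<open>
  Cells with the same number of even coordinates, the colour of the cell, do not overlap.
  Otherwise there are a coordinate \<open>p\<close> that is even only in \<open>c\<close> and a coordinate \<open>q\<close> that is even
  only in \<open>d\<close>. Positivity of both weights bounds the sum of the four distances involved by less
  than 2, but two distinct integers have total distance at least 1 from any real number.
\<close>

lemma cell_weight_disjoint:
  assumes I: "finite I"
    and pos: "0 < cell_weight I c z" "0 < cell_weight I d z"
    and card: "card {i\<in>I. even (c i)} = card {i\<in>I. even (d i)}"
    and "i \<in> I"
  shows "c i = d i"
proof -
  note c = pos(1)[unfolded cell_weight_pos_iff[OF I]]
  note d = pos(2)[unfolded cell_weight_pos_iff[OF I]]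
  have fin: "finite {i\<in>I. even (c i)}" "finite {i\<in>I. even (d i)}" using I by auto
  have same: "{i\<in>I. even (c i)} = {i\<in>I. even (d i)}"
  proof (rule ccontr)
    assume neq: "{i\<in>I. even (c i)} \<noteq> {i\<in>I. even (d i)}"
    have "\<not> {i\<in>I. even (c i)} \<subseteq> {i\<in>I. even (d i)}"
      using card_subset_eq[OF fin(2) _ card] neq by blast
    then obtain p where p: "p \<in> I" "even (c p)" "odd (d p)" by auto
    have "\<not> {i\<in>I. even (d i)} \<subseteq> {i\<in>I. even (c i)}"
      using card_subset_eq[OF fin(1) _ card[symmetric]] neq by blast
    then obtain q where q: "q \<in> I" "even (d q)" "odd (c q)" by auto
    have "\<bar>z p - c p\<bar> + \<bar>z q - c q\<bar> < 1" "\<bar>z q - d q\<bar> + \<bar>z p - d p\<bar> < 1"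
      using c d p q by simp_all
    moreover have "c p \<noteq> d p" "c q \<noteq> d q" using p q by auto
    note this[THEN int_dist_ge_1, of "z p"] this[THEN int_dist_ge_1, of "z q"]
    ultimately show False by linarith
  qed
  have "\<bar>z i - c i\<bar> < 1" "\<bar>z i - d i\<bar> < 1" using c d \<open>i \<in> I\<close> by auto
  then have "\<bar>c i - d i\<bar> < 2" by linarith
  moreover have "even (c i) \<longleftrightarrow> even (d i)" using same \<open>i \<in> I\<close> by auto
  then have "even (c i - d i)" by simp
  ultimately show ?thesis by presburger
qed

text \<open>
  A point lies in the cell of the smallest face that contains it: round the even integers among
  its coordinates to themselves and all others to the nearest odd integer.
\<close>

lemma cell_weight_cover:
  assumes I: "finite I" and z: "\<And>i. i \<in> I \<Longrightarrow> 0 \<le> z i \<and> z i \<le> 2 * real M"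
  shows "\<exists>c \<in> PiE I (\<lambda>_. {0..2 * int M}). 0 < cell_weight I c z"
proof -
  define c0 where "c0 t = (if t / 2 = \<lfloor>t / 2\<rfloor> then 2 * \<lfloor>t / 2\<rfloor> else 2 * \<lfloor>t / 2\<rfloor> + 1)" for t :: real
  have c0: "(even (c0 t) \<longrightarrow> t = c0 t) \<and> \<bar>t - c0 t\<bar> < 1" for t
  proof (cases "t / 2 = \<lfloor>t / 2\<rfloor>")
    case True
    then show ?thesis unfolding c0_def by simp
  next
    case False
    then have "\<lfloor>t / 2\<rfloor> < t / 2" "t / 2 < \<lfloor>t / 2\<rfloor> + 1" by linarith+
    then have "\<bar>t - (2 * \<lfloor>t / 2\<rfloor> + 1)\<bar> < 1" by linarith
    with False show ?thesis unfolding c0_def by simp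
  qed
  have c0_range: "c0 t \<in> {0..2 * int M}" if t: "0 \<le> t \<and> t \<le> 2 * real M" for t
  proof (cases "t / 2 = \<lfloor>t / 2\<rfloor>")
    case True
    then show ?thesis using t unfolding c0_def by (simp add: le_floor_iff floor_le_iff)
  next
    case False
    then have "\<lfloor>t / 2\<rfloor> < t / 2" by linarith
    then have "\<lfloor>t / 2\<rfloor> < int M" using t by linarith
    moreover have "0 \<le> \<lfloor>t / 2\<rfloor>" using t by simp
    ultimately show ?thesis using False unfolding c0_def by auto
  qed
  define c where "c = restrict (\<lambda>i. c0 (z i)) I"
  have "0 < cell_weight I c z"
    unfolding cell_weight_pos_iff[OF I] c_def using c0 by (auto simp: algebra_simps) 
  moreover have "c \<in> PiE I (\<lambda>_. {0..2 * int M})"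
    unfolding c_def using z c0_range by (auto simp: PiE_iff)
  ultimately show ?thesis by blast
qed

section \<open>A colourful variational inequality\<close>

text \<open>A fixed point of the map sending \<open>x\<close> to the point of \<open>K\<close> closest to \<open>x + F x\<close> is a solution,
  because the vector from the closest point to \<open>x + F x\<close> is then \<open>F x\<close>.\<close>

lemma variational_inequality:
  fixes K :: "'a::euclidean_space set"
  assumes K: "compact K" "convex K" "K \<noteq> {}" and F: "continuous_on K F"
  shows "\<exists>x\<in>K. \<forall>y\<in>K. F x \<bullet> (y - x) \<le> 0"
proof -
  have cl: "closed K" using K(1) by (rule compact_imp_closed)
  have "continuous_on K (\<lambda>x. closest_point K (x + F x))"
    by (rule continuous_on_compose2[OF continuous_on_closest_point[OF K(2) cl K(3), of UNIV]])
       (auto intro!: continuous_intros F)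
  then obtain x where x: "x \<in> K" "closest_point K (x + F x) = x"
    using closest_point_in_set[OF cl K(3)] by (auto intro: brouwer[OF K])
  then have "F x \<bullet> (y - x) \<le> 0" if "y \<in> K" for y
    using closest_point_dot[OF K(2) cl that, of "x + F x"] by simp
  then show ?thesis using x(1) by blast
qed

text \<open>
  The map fed into the variational inequality interpolates, with the weights \<open>W\<close>, the points
  \<open>g (s c)\<close> where \<open>s c\<close> is acceptable to the owner \<open>col c\<close> of the cell \<open>c\<close> at some point \<open>v c\<close> of
  the cell. At the solution \<open>x\<close> each owner has at most one cell of positive weight, so each owner
  contributes at most one point to the convex combination. The relation \<open>near\<close> records the size of
  the cells.
\<close>

lemma coloured_partition_variational_inequality:
  fixes K :: "'a::euclidean_space set" and C :: "'e \<Rightarrow> 's \<Rightarrow> 'a set"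
    and W :: "'t \<Rightarrow> 'a \<Rightarrow> real" and col :: "'t \<Rightarrow> 'e" and near :: "'a \<Rightarrow> 'a \<Rightarrow> bool"
  assumes K: "compact K" "convex K" "K \<noteq> {}"
    and T: "finite T" "\<And>c. c \<in> T \<Longrightarrow> col c \<in> E"
    and W0: "\<And>c x. c \<in> T \<Longrightarrow> 0 \<le> W c x"
    and W_cont: "\<And>c. c \<in> T \<Longrightarrow> continuous_on K (W c)"
    and W_cover: "\<And>x. x \<in> K \<Longrightarrow> \<exists>c\<in>T. 0 < W c x"
    and W_inj: "\<And>c d x. c \<in> T \<Longrightarrow> d \<in> T \<Longrightarrow> 0 < W c x \<Longrightarrow> 0 < W d x \<Longrightarrow> col c = col d \<Longrightarrow> c = d"
    and near_refl: "\<And>x. near x x"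
    and W_near: "\<And>c v x. c \<in> T \<Longrightarrow> 0 < W c v \<Longrightarrow> 0 < W c x \<Longrightarrow> near v x"
    and C: "\<And>e x. e \<in> E \<Longrightarrow> x \<in> K \<Longrightarrow> \<exists>s. x \<in> C e s"
  shows "\<exists>sel x f v. x \<in> K \<and>
     (\<forall>e\<in>E. v e \<in> K \<and> v e \<in> C e (sel e) \<and> near (v e) x) \<and>
     f \<in> convex hull ((\<lambda>e. g (sel e)) ` E) \<and> (\<forall>y\<in>K. f \<bullet> (y - x) \<le> 0)"
proof -
  define tot where "tot x = (\<Sum>c\<in>T. W c x)" for x
  have tot: "0 < tot x" if x: "x \<in> K" for x
  proof -
    obtain c where "c \<in> T" "0 < W c x" using W_cover[OF x] by blast
    then show ?thesis unfolding tot_def using W0 T by (intro sum_pos2[of T c]) auto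
  qed
  \<comment> \<open>A cell may miss \<open>K\<close>; its sample is then arbitrary and never enters the interpolation.\<close>
  define sample where
    "sample c v s \<longleftrightarrow> (\<forall>x\<in>K. 0 < W c x \<longrightarrow> v \<in> K \<and> 0 < W c v \<and> v \<in> C (col c) s)" for c v s
  have "\<exists>v s. sample c v s" if c: "c \<in> T" for c
  proof (cases "\<exists>x\<in>K. 0 < W c x")
    case True
    then obtain v where v: "v \<in> K" "0 < W c v" by blast
    moreover obtain s where "v \<in> C (col c) s" using C[OF T(2)[OF c] v(1)] by blast
    ultimately have "sample c v s" by (simp add: sample_def)
    then show ?thesis by blast
  qed (simp add: sample_def)
  then obtain v s where "\<And>c. c \<in> T \<Longrightarrow> sample c (v c) (s c)" by metis
  then have vs: "v c \<in> K \<and> 0 < W c (v c) \<and> v c \<in> C (col c) (s c)"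
    if "c \<in> T" "x \<in> K" "0 < W c x" for c x
    using that unfolding sample_def by blast
  define F where "F x = (\<Sum>c\<in>T. (W c x / tot x) *\<^sub>R g (s c))" for x
  have "continuous_on K tot"
    unfolding tot_def using W_cont by (intro continuous_intros)
  then have "continuous_on K F"
    unfolding F_def using W_cont tot by (intro continuous_intros) (auto simp: less_le)
  then obtain x where x: "x \<in> K" "\<forall>y\<in>K. F x \<bullet> (y - x) \<le> 0"
    using variational_inequality[OF K] by blast
  define active where "active e c \<longleftrightarrow> c \<in> T \<and> 0 < W c x \<and> col c = e" for e c
  have active_unique: "c = d" if "active e c" "active e d" for e c d
    using that W_inj unfolding active_def by blast
  \<comment> \<open>An owner with a cell of positive weight at \<open>x\<close> must use the sample of that cell; any other
    owner simply chooses at \<open>x\<close> itself.\<close>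
  define suits where "suits e p \<longleftrightarrow> fst p \<in> K \<and> fst p \<in> C e (snd p) \<and> near (fst p) x \<and>
      (\<forall>c. active e c \<longrightarrow> snd p = s c)" for e p
  have "\<exists>p. suits e p" if e: "e \<in> E" for e
  proof (cases "\<exists>c. active e c")
    case True
    then obtain c where c: "active e c" by blast
    then have c': "c \<in> T" "0 < W c x" "col c = e" by (simp_all add: active_def)
    note v = vs[OF c'(1) x(1) c'(2)]
    have "near (v c) x" using W_near[OF c'(1) _ c'(2)] v by simp
    moreover have "\<forall>d. active e d \<longrightarrow> s c = s d" using active_unique[OF c] by blast
    ultimately have "suits e (v c, s c)" using v c'(3) unfolding suits_def by simp
    then show ?thesis by blast
  next
    case False
    obtain s0 where "x \<in> C e s0" using C[OF e x(1)] by blast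
    then have "suits e (x, s0)" using False x(1) near_refl unfolding suits_def by simp
    then show ?thesis by blast
  qed
  then obtain p where p: "\<And>e. e \<in> E \<Longrightarrow> suits e (p e)" by metis
  define V where "V = fst \<circ> p"
  define S where "S = snd \<circ> p"
  have V: "V e \<in> K \<and> V e \<in> C e (S e) \<and> near (V e) x"
    if "e \<in> E" for e
    using p[OF that] unfolding suits_def V_def S_def by simp
  have S: "S (col c) = s c" if "c \<in> T" "0 < W c x" for c
    using p[OF T(2)[OF that(1)]] that unfolding suits_def S_def active_def by simp
  define T' where "T' = {c\<in>T. 0 < W c x}"
  have T': "finite T'" "T' \<subseteq> T" "\<forall>c\<in>T - T'. W c x = 0"
    using T W0 by (auto simp: T'_def less_le)
  have "F x = (\<Sum>c\<in>T'. (W c x / tot x) *\<^sub>R g (s c))"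
    unfolding F_def using T T' by (intro sum.mono_neutral_right) auto
  also have "\<dots> \<in> convex hull ((\<lambda>e. g (S e)) ` E)"
  proof (rule convex_sum[OF T'(1) convex_convex_hull])
    have "(\<Sum>c\<in>T'. W c x / tot x) = (\<Sum>c\<in>T. W c x / tot x)"
      using T T' by (intro sum.mono_neutral_left) auto
    also have "\<dots> = 1"
      using tot[OF x(1)] by (simp add: sum_divide_distrib[symmetric] tot_def)
    finally show "(\<Sum>c\<in>T'. W c x / tot x) = 1" .
    fix c assume "c \<in> T'"
    then have c: "c \<in> T" "0 < W c x" by (auto simp: T'_def)
    show "0 \<le> W c x / tot x" using c tot[OF x(1)] by simp
    show "g (s c) \<in> convex hull ((\<lambda>e. g (S e)) ` E)"
      using S[OF c] T(2)[OF c(1)] by (intro hull_inc image_eqI[of _ _ "col c"]) auto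
  qed
  finally have hull: "F x \<in> convex hull ((\<lambda>e. g (S e)) ` E)" .
  show ?thesis
    by (rule exI[of _ S], rule exI[of _ x], rule exI[of _ "F x"], rule exI[of _ V])
       (use V hull x in simp)
qed

text \<open>Here \<open>M\<close> is the fineness: the coordinates are stretched by \<open>2 * M\<close>, so that cells, which have
  radius 1 in every coordinate, become cells of diameter \<open>1/M\<close>.\<close>

lemma approximate_colourful_variational_inequality:
  fixes K :: "'a::euclidean_space set" and C :: "'e \<Rightarrow> 's \<Rightarrow> 'a set" and y :: "'i \<Rightarrow> 'a \<Rightarrow> real"
  assumes K: "compact K" "convex K" "K \<noteq> {}"
    and I: "finite I" and y: "\<And>i. i \<in> I \<Longrightarrow> continuous_on K (y i)"
    and y01: "\<And>i x. i \<in> I \<Longrightarrow> x \<in> K \<Longrightarrow> 0 \<le> y i x \<and> y i x \<le> 1"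
    and E: "finite E" "card E = card I + 1"
    and C: "\<And>e x. e \<in> E \<Longrightarrow> x \<in> K \<Longrightarrow> \<exists>s. x \<in> C e s"
    and M: "M > 0"
  shows "\<exists>sel x f v. x \<in> K \<and>
     (\<forall>e\<in>E. v e \<in> K \<and> v e \<in> C e (sel e) \<and> (\<forall>i\<in>I. \<bar>y i (v e) - y i x\<bar> \<le> 1 / real M)) \<and>
     f \<in> convex hull ((\<lambda>e. g (sel e)) ` E) \<and> (\<forall>y\<in>K. f \<bullet> (y - x) \<le> 0)"
proof -
  define Z where "Z x i = 2 * real M * y i x" for x i
  define T where "T = PiE I (\<lambda>_. {0..2 * int M})"
  define W where "W c x = cell_weight I c (Z x)" for c x
  have "finite {0..card I}" "card {0..card I} = card E" using E by auto
  then obtain colour where colour: "bij_betw colour {0..card I} E"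
    using finite_same_card_bij E(1) by blast
  define col where "col c = colour (card {i\<in>I. even (c i)})" for c :: "'i \<Rightarrow> int"
  have num: "card {i\<in>I. even (c i)} \<in> {0..card I}" for c :: "'i \<Rightarrow> int"
    using I by (auto intro!: card_mono)
  have W_near: "\<bar>y i v - y i x\<bar> \<le> 1 / real M" if W: "0 < W c x" "0 < W c v" and i: "i \<in> I" for c x v i
  proof -
    have "\<bar>Z x i - c i\<bar> < 1" "\<bar>Z v i - c i\<bar> < 1"
      using W i unfolding W_def cell_weight_pos_iff[OF I] by simp_all
    then have "\<bar>Z v i - Z x i\<bar> \<le> 2" by linarith
    moreover have "Z v i - Z x i = 2 * real M * (y i v - y i x)"
      by (simp add: Z_def algebra_simps)
    ultimately have "real M * \<bar>y i v - y i x\<bar> \<le> 1" by (simp add: abs_mult)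
    then show ?thesis using M by (simp add: field_simps)
  qed
  show ?thesis
  proof (rule coloured_partition_variational_inequality[OF K, where col = col and T = T and W = W and C = C and g = g and E = E
        and near = "\<lambda>v x. \<forall>i\<in>I. \<bar>y i v - y i x\<bar> \<le> 1 / real M"])
    show "finite T" unfolding T_def using I by (intro finite_PiE) auto
    show "col c \<in> E" for c unfolding col_def using bij_betwE[OF colour] num by simp
    show "0 \<le> W c x" for c x unfolding W_def by (rule cell_weight_nonneg)
    show "continuous_on K (W c)" for c
      unfolding W_def
    proof (rule continuous_on_cell_weight)
      show "continuous_on K (\<lambda>x. Z x i)" if "i \<in> I" for i
        unfolding Z_def using y[OF that] by (rule continuous_on_mult_left)
    qed
    show "\<exists>c\<in>T. 0 < W c x" if "x \<in> K" for x
      unfolding W_def T_def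
    proof (rule cell_weight_cover[OF I])
      show "0 \<le> Z x i \<and> Z x i \<le> 2 * real M" if "i \<in> I" for i
        using y01[OF that \<open>x \<in> K\<close>] by (simp add: Z_def mult_left_le)
    qed
    show "c = d" if "c \<in> T" "d \<in> T" "0 < W c x" "0 < W d x" "col c = col d" for c d x
    proof -
      have "card {i\<in>I. even (c i)} = card {i\<in>I. even (d i)}"
        using bij_betw_imp_inj_on[OF colour] that(5)[unfolded col_def] num num by (rule inj_onD)
      note eq = cell_weight_disjoint[OF I that(3,4)[unfolded W_def] this]
      show ?thesis by (rule PiE_ext[OF that(1,2)[unfolded T_def]]) (rule eq)
    qed
    show "\<forall>i\<in>I. \<bar>y i x - y i x\<bar> \<le> 1 / real M" for x by simp
    show "\<forall>i\<in>I. \<bar>y i v - y i x\<bar> \<le> 1 / real M" if "0 < W c v" "0 < W c x" for c v x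
      by (intro ballI W_near[OF that(2,1)])
    show "\<exists>s. x \<in> C e s" if "e \<in> E" "x \<in> K" for e x using C that .
  qed
qed

text \<open>
  The functions \<open>y i\<close> are coordinates on \<open>K\<close>, so \<open>card I\<close> bounds its dimension. The selections take
  only finitely many values, so one choice of selections serves arbitrarily fine meshes, and for
  this choice a limit point of the approximate solutions is a solution.
\<close>

lemma colourful_variational_inequality:
  fixes K :: "'a::euclidean_space set" and C :: "'e \<Rightarrow> 's::finite \<Rightarrow> 'a set" and y :: "'i \<Rightarrow> 'a \<Rightarrow> real"
  assumes K: "compact K" "convex K" "K \<noteq> {}"
    and I: "finite I" and y: "\<And>i. i \<in> I \<Longrightarrow> continuous_on K (y i)"
    and y01: "\<And>i x. i \<in> I \<Longrightarrow> x \<in> K \<Longrightarrow> 0 \<le> y i x \<and> y i x \<le> 1"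
    and y_dist: "\<And>u v r. u \<in> K \<Longrightarrow> v \<in> K \<Longrightarrow> (\<And>i. i \<in> I \<Longrightarrow> \<bar>y i u - y i v\<bar> \<le> r) \<Longrightarrow> 0 \<le> r \<Longrightarrow> dist u v \<le> B * r"
    and E: "finite E" "card E = card I + 1"
    and C: "\<And>e x. e \<in> E \<Longrightarrow> x \<in> K \<Longrightarrow> \<exists>s. x \<in> C e s"
    and closed: "\<And>e s. e \<in> E \<Longrightarrow> closed (C e s)"
  shows "\<exists>x\<in>K. \<exists>sel f. (\<forall>e\<in>E. x \<in> C e (sel e)) \<and>
     f \<in> convex hull ((\<lambda>e. g (sel e)) ` E) \<and> (\<forall>y\<in>K. f \<bullet> (y - x) \<le> 0)"
proof -
  define good where "good sel x f v M \<longleftrightarrow> x \<in> K \<and>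
     (\<forall>e\<in>E. v e \<in> K \<and> v e \<in> C e (sel e) \<and> (\<forall>i\<in>I. \<bar>y i (v e) - y i x\<bar> \<le> 1 / real M)) \<and>
     f \<in> convex hull ((\<lambda>e. g (sel e)) ` E) \<and> (\<forall>y\<in>K. f \<bullet> (y - x) \<le> 0)" for sel x f v M
  have "\<forall>m. \<exists>sel\<in>PiE E (\<lambda>_. UNIV). \<exists>x f v. good sel x f v (Suc m)"
  proof
    fix m
    have "\<exists>sel x f v. good sel x f v (Suc m)"
      unfolding good_def
      by (rule approximate_colourful_variational_inequality[OF K I y y01 E C]) simp_all
    then obtain sel x f v where "good sel x f v (Suc m)" by blast
    then have "good (restrict sel E) x f v (Suc m)" by (simp add: good_def cong: image_cong)
    moreover have "restrict sel E \<in> PiE E (\<lambda>_. UNIV)" by simp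
    ultimately show "\<exists>sel\<in>PiE E (\<lambda>_. UNIV). \<exists>x f v. good sel x f v (Suc m)" by blast
  qed
  then have "\<exists>sel\<in>PiE E (\<lambda>_. UNIV). infinite {m\<in>UNIV. \<exists>x f v. good sel x f v (Suc m)}"
    using E(1) by (intro pigeonhole_infinite_rel finite_PiE) auto
  then obtain sel where sel: "infinite {m. \<exists>x f v. good sel x f v (Suc m)}" by auto
  have "\<exists>x f v. good sel x f v (Suc m)" for m
  proof -
    obtain m' x f v where m': "m \<le> m'" "good sel x f v (Suc m')"
      using sel unfolding infinite_nat_iff_unbounded_le by blast
    have "1 / real (Suc m') \<le> 1 / real (Suc m)" using m'(1) by (simp add: frac_le)
    then have "good sel x f v (Suc m)"
      using m'(2) unfolding good_def
      by (auto simp del: of_nat_Suc intro: order_trans[of _ "1 / real (Suc m')"])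
    then show ?thesis by blast
  qed
  then obtain x f v where good: "\<And>m. good sel (x m) (f m) (v m) (Suc m)" by metis
  \<comment> \<open>The hull of the chosen points is compact, so the combinations \<open>f m\<close> have a limit point that
    is again such a combination.\<close>
  define H where "H = convex hull ((\<lambda>e. g (sel e)) ` E)"
  have "compact H" unfolding H_def using E(1) by (intro finite_imp_compact_convex_hull) auto
  then have "compact (K \<times> H)" using K(1) by (intro compact_Times)
  moreover have "(x m, f m) \<in> K \<times> H" for m using good[of m] by (simp add: good_def H_def)
  ultimately have "\<exists>l\<in>K \<times> H. \<exists>r. strict_mono r \<and> ((\<lambda>m. (x m, f m)) \<circ> r) \<longlonglongrightarrow> l"
    by (intro compact_def[THEN iffD1, rule_format]) auto
  then obtain l r where l: "l \<in> K \<times> H" "strict_mono r" "((\<lambda>m. (x m, f m)) \<circ> r) \<longlonglongrightarrow> l"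
    by blast
  obtain x' f' where l': "l = (x', f')" by (cases l)
  have x': "x' \<in> K" "(\<lambda>m. x (r m)) \<longlonglongrightarrow> x'" and f': "f' \<in> H" "(\<lambda>m. f (r m)) \<longlonglongrightarrow> f'"
    using l tendsto_fst[OF l(3)] tendsto_snd[OF l(3)] by (auto simp: l' o_def)
  have "x' \<in> C e (sel e)" if e: "e \<in> E" for e
  proof -
    have "dist (v m e) (x m) \<le> B * (1 / real (Suc m))" for m
      using good[of m] e unfolding good_def by (intro y_dist) auto
    then have bound: "dist (v (r m) e) (x (r m)) \<le> B * (1 / real (Suc (r m)))" for m by blast
    have "(\<lambda>m. B * (1 / real (Suc m))) \<longlonglongrightarrow> B * 0"
      by (intro tendsto_intros LIMSEQ_Suc lim_1_over_n)
    then have lim: "(\<lambda>m. B * (1 / real (Suc (r m)))) \<longlonglongrightarrow> 0"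
      using LIMSEQ_subseq_LIMSEQ[OF _ l(2)] by (fastforce simp: o_def)
    have "(\<lambda>m. dist (v (r m) e) (x (r m))) \<longlonglongrightarrow> 0"
      by (rule tendsto_sandwich[OF _ _ tendsto_const lim]) (use bound in auto)
    then have "(\<lambda>m. v (r m) e - x (r m)) \<longlonglongrightarrow> 0"
      by (simp add: dist_norm tendsto_norm_zero_iff)
    from tendsto_add[OF this x'(2)] have v_lim: "(\<lambda>m. v (r m) e) \<longlonglongrightarrow> x'" by simp
    have "v (r m) e \<in> C e (sel e)" for m
      using good[of "r m"] e by (auto simp: good_def)
    then show ?thesis by (rule closed_sequentially[OF closed[OF e] _ v_lim])
  qed
  moreover have "f' \<bullet> (y - x') \<le> 0" if "y \<in> K" for y
  proof (rule LIMSEQ_le_const2)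
    show "(\<lambda>m. f (r m) \<bullet> (y - x (r m))) \<longlonglongrightarrow> f' \<bullet> (y - x')"
      by (intro tendsto_intros x' f')
    show "\<exists>N. \<forall>n\<ge>N. f (r n) \<bullet> (y - x (r n)) \<le> 0"
      using good that by (auto simp: good_def)
  qed
  ultimately show ?thesis
    using x'(1) f'(1) unfolding H_def by (intro bexI[of _ x'] exI[of _ sel] exI[of _ f']) simp_all
qed

section \<open>The polytope of partitions\<close>

definition selection_vertex :: "('n::finite, 'k::finite) selection \<Rightarrow> real^'n^'k" where
  "selection_vertex s = (\<chi> j i. if s j = i then 1 else 0)"

lemma selection_vertex_nth [simp]: "selection_vertex s $ j $ i = (if s j = i then 1 else 0)"
  by (simp add: selection_vertex_def)

lemma day_partitions_iff:
  "x \<in> day_partitions \<longleftrightarrow> (\<forall>j i. 0 \<le> x $ j $ i) \<and> (\<forall>j. (\<Sum>i\<in>UNIV. x $ j $ i) = 1)"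
  by (auto simp: day_partitions_def simplex_points_def)

lemma day_partitions_le_1:
  assumes "x \<in> day_partitions"
  shows "x $ j $ i \<le> 1"
proof -
  have "x $ j $ i \<le> (\<Sum>i\<in>UNIV. x $ j $ i)"
    using assms by (intro member_le_sum) (auto simp: day_partitions_iff)
  then show ?thesis using assms by (simp add: day_partitions_iff)
qed

lemma selection_vertex_in_day_partitions: "selection_vertex s \<in> day_partitions"
  by (simp add: day_partitions_iff)

lemma convex_day_partitions: "convex (day_partitions :: (real^'n::finite^'k::finite) set)"
proof (rule convexI)
  fix x y :: "real^'n^'k" and u v :: real
  assume x: "x \<in> day_partitions" and y: "y \<in> day_partitions" and uv: "0 \<le> u" "0 \<le> v" "u + v = 1"
  have "(\<Sum>i\<in>UNIV. (u *\<^sub>R x + v *\<^sub>R y) $ j $ i) = u * (\<Sum>i\<in>UNIV. x $ j $ i) + v * (\<Sum>i\<in>UNIV. y $ j $ i)" for j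
    by (simp add: sum.distrib sum_distrib_left)
  with x y uv show "u *\<^sub>R x + v *\<^sub>R y \<in> day_partitions"
    by (simp add: day_partitions_iff)
qed

lemma norm_matrix_le_sum:
  fixes x :: "real^'n::finite^'k::finite"
  shows "norm x \<le> (\<Sum>j\<in>UNIV. \<Sum>i\<in>UNIV. \<bar>x $ j $ i\<bar>)"
proof -
  have "norm x \<le> (\<Sum>j\<in>UNIV. norm (x $ j))"
    unfolding norm_vec_def[of x] by (rule L2_set_le_sum) simp
  also have "\<dots> \<le> (\<Sum>j\<in>UNIV. \<Sum>i\<in>UNIV. \<bar>x $ j $ i\<bar>)"
    by (intro sum_mono norm_le_l1_cart)
  finally show ?thesis .
qed

lemma compact_day_partitions: "compact (day_partitions :: (real^'n::finite^'k::finite) set)"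
proof -
  have "norm x \<le> (\<Sum>j\<in>(UNIV::'k set). \<Sum>i\<in>(UNIV::'n set). 1)" if "x \<in> day_partitions" for x :: "real^'n^'k"
  proof (rule order_trans[OF norm_matrix_le_sum], intro sum_mono)
    show "\<bar>x $ j $ i\<bar> \<le> 1" for j i
      using that day_partitions_le_1[OF that] by (simp add: day_partitions_iff)
  qed
  then have "bounded (day_partitions :: (real^'n^'k) set)"
    unfolding bounded_iff by blast
  moreover have "closed (day_partitions :: (real^'n^'k) set)"
    unfolding day_partitions_def simplex_points_def mem_Collect_eq
    by (intro closed_Collect_all closed_Collect_conj closed_Collect_le closed_Collect_eq continuous_intros)
  ultimately show ?thesis by (simp add: compact_eq_bounded_closed)
qed

text \<open>The lengths on each day add up to 1, so the shift \<open>i0\<close> is determined by the others. This is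
  what makes \<open>k(n - 1)\<close> coordinates suffice.\<close>

lemma day_partitions_dist_le:
  fixes u v :: "real^'n::finite^'k::finite" and i0 :: 'n
  assumes u: "u \<in> day_partitions" and v: "v \<in> day_partitions" and r: "0 \<le> r"
    and close: "\<And>j i. i \<noteq> i0 \<Longrightarrow> \<bar>u $ j $ i - v $ j $ i\<bar> \<le> r"
  shows "dist u v \<le> (real CARD('k) * real CARD('n) * real CARD('n)) * r"
proof -
  have entry: "\<bar>u $ j $ i - v $ j $ i\<bar> \<le> real CARD('n) * r" for j i
  proof (cases "i = i0")
    case True
    have "(\<Sum>i\<in>UNIV. u $ j $ i - v $ j $ i) = 0"
      using u v by (simp add: sum_subtractf day_partitions_iff)
    then have "u $ j $ i0 - v $ j $ i0 = - (\<Sum>i\<in>UNIV - {i0}. u $ j $ i - v $ j $ i)"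
      by (simp add: sum.remove[of UNIV i0])
    then have "\<bar>u $ j $ i0 - v $ j $ i0\<bar> \<le> (\<Sum>i\<in>UNIV - {i0}. \<bar>u $ j $ i - v $ j $ i\<bar>)"
      by (simp only: abs_minus_cancel sum_abs)
    also have "\<dots> \<le> (\<Sum>i\<in>UNIV - {i0}. r)"
      by (intro sum_mono close) auto
    also have "\<dots> \<le> (\<Sum>i\<in>(UNIV::'n set). r)"
      using r by (intro sum_mono2) auto
    finally show ?thesis using True by simp
  next
    case False
    have "1 * r \<le> real CARD('n) * r"
      using r by (intro mult_right_mono) (auto simp: Suc_le_eq)
    then show ?thesis using close[OF False, of j] by simp
  qed
  have "dist u v \<le> (\<Sum>j\<in>UNIV. \<Sum>i\<in>UNIV. \<bar>(u - v) $ j $ i\<bar>)"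
    unfolding dist_norm by (rule norm_matrix_le_sum)
  also have "\<dots> \<le> (\<Sum>j\<in>(UNIV::'k set). \<Sum>i\<in>(UNIV::'n set). real CARD('n) * r)"
    using entry by (intro sum_mono) simp
  finally show ?thesis by simp
qed

section \<open>Fractionally covered partitions\<close>

text \<open>Moving the whole length of a nonempty shift \<open>i\<close> of day \<open>j\<close> over to shift \<open>i'\<close> leads to
  another partition; the variational inequality tested against it compares the two entries.\<close>

lemma variational_inequality_entries:
  fixes x f :: "real^'n::finite^'k::finite"
  assumes x: "x \<in> day_partitions" and vi: "\<And>y. y \<in> day_partitions \<Longrightarrow> f \<bullet> (y - x) \<le> 0"
    and pos: "0 < x $ j $ i"
  shows "f $ j $ i' \<le> f $ j $ i"
proof (cases "i' = i")
  case False
  define y where "y = x + (x $ j $ i) *\<^sub>R axis j (axis i' 1 - axis i 1)"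
  have "y $ l $ m = x $ l $ m + (if l = j then x $ j $ i * (if m = i' then 1 else 0) - x $ j $ i * (if m = i then 1 else 0) else 0)" for l m
    by (simp add: y_def axis_def)
  note y_nth = this
  have "y \<in> day_partitions"
    unfolding day_partitions_iff
  proof (intro conjI allI)
    fix l m
    show "0 \<le> y $ l $ m"
      using x pos False by (auto simp: y_nth day_partitions_iff)
  next
    fix l
    show "(\<Sum>m\<in>UNIV. y $ l $ m) = 1"
      using x by (cases "l = j") (simp_all add: y_nth day_partitions_iff sum.distrib sum_subtractf flip: sum_distrib_left)
  qed
  then have "f \<bullet> (y - x) \<le> 0" by (rule vi)
  then have "x $ j $ i * (f $ j $ i' - f $ j $ i) \<le> 0"
    by (simp add: y_def inner_axis inner_diff_right)
  with pos show ?thesis by (simp add: mult_le_0_iff)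
qed simp

text \<open>The convex combination supplied by the colourful variational inequality is the barycentre; its
  coefficients, multiplied by \<open>n\<close>, are the weights \<open>w\<close>.\<close>

lemma fractionally_covered_partition:
  fixes C :: "'e \<Rightarrow> ('n::finite, 'k::finite) preferences"
  assumes E: "finite E" "card E = CARD('k) * (CARD('n) - 1) + 1"
    and accepts: "\<And>e. e \<in> E \<Longrightarrow> always_accepts_some (C e)"
    and prefers_empty: "\<And>e. e \<in> E \<Longrightarrow> prefers_empty_shifts (C e)"
    and closed: "\<And>e s. e \<in> E \<Longrightarrow> closed (C e s)"
  shows "\<exists>x\<in>day_partitions. \<exists>sel N w. N \<subseteq> E \<and> (\<forall>e\<in>N. x \<in> C e (sel e) \<and> 0 \<le> w e) \<and>
    (\<forall>j i. (\<Sum>e\<in>{e\<in>N. sel e j = i}. w e) = (1::real))"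
proof -
  obtain i0 :: 'n where True by simp
  define I :: "('k \<times> 'n) set" where "I = UNIV \<times> (UNIV - {i0})"
  define coord where "coord p x = x $ fst p $ snd p" for p and x :: "real^'n^'k"
  have card_I: "card E = card I + 1"
    unfolding E(2) I_def by (simp add: card_cartesian_product)
  have "\<exists>x\<in>day_partitions. \<exists>sel f. (\<forall>e\<in>E. x \<in> C e (sel e)) \<and>
     f \<in> convex hull ((\<lambda>e. selection_vertex (sel e)) ` E) \<and> (\<forall>y\<in>day_partitions. f \<bullet> (y - x) \<le> 0)"
  proof (rule colourful_variational_inequality[where I = I and y = coord
        and K = "day_partitions" and C = C and g = selection_vertex])
    show "compact (day_partitions :: (real^'n^'k) set)" by (rule compact_day_partitions)
    show "convex (day_partitions :: (real^'n^'k) set)" by (rule convex_day_partitions)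
    show "day_partitions \<noteq> ({} :: (real^'n^'k) set)"
      using selection_vertex_in_day_partitions by blast
    show "finite I" by simp
    show "continuous_on day_partitions (coord p)" for p
      unfolding coord_def by (intro continuous_intros)
    show "0 \<le> coord p x \<and> coord p x \<le> 1" if "x \<in> day_partitions" for p x
      using that day_partitions_le_1[OF that] by (simp add: coord_def day_partitions_iff)
    show "dist u v \<le> (real CARD('k) * real CARD('n) * real CARD('n)) * r"
      if "u \<in> day_partitions" "v \<in> day_partitions" "\<And>p. p \<in> I \<Longrightarrow> \<bar>coord p u - coord p v\<bar> \<le> r" "0 \<le> r"
      for u v r
    proof (rule day_partitions_dist_le[OF that(1,2,4), of i0])
      show "\<bar>u $ j $ i - v $ j $ i\<bar> \<le> r" if "i \<noteq> i0" for j i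
        using \<open>\<And>p. p \<in> I \<Longrightarrow> _\<close>[of "(j, i)"] that by (simp add: I_def coord_def)
    qed
    show "\<exists>s. x \<in> C e s" if "e \<in> E" "x \<in> day_partitions" for e x
      using accepts[OF that(1)] that(2) by (simp add: always_accepts_some_def)
  qed (use E card_I closed in simp_all)
  then obtain x sel f where x: "x \<in> day_partitions" and sel_E: "\<forall>e\<in>E. x \<in> C e (sel e)"
    and f: "f \<in> convex hull ((\<lambda>e. selection_vertex (sel e)) ` E)"
    and vi_all: "\<forall>y\<in>day_partitions. f \<bullet> (y - x) \<le> 0"
    by (elim bexE exE conjE) (rule that, assumption+)
  have sel: "x \<in> C e (sel e)" if "e \<in> E" for e using sel_E that by simp
  have vi: "f \<bullet> (y - x) \<le> 0" if "y \<in> day_partitions" for y using vi_all that by simp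
  define P where "P e = selection_vertex (sel e)" for e
  \<comment> \<open>Employees may have chosen the same selection, so keep one employee for each vertex.\<close>
  obtain N where N: "N \<subseteq> E" "inj_on P N" "P ` E = P ` N"
    using subset_image_inj[of "P ` E" P E] by auto
  have finN: "finite N" using N(1) E(1) finite_subset by blast
  obtain u where u: "\<And>e. e \<in> N \<Longrightarrow> 0 \<le> u (P e)" "sum u (P ` N) = 1"
      "(\<Sum>p\<in>P ` N. u p *\<^sub>R p) = f"
    using f finN unfolding P_def[symmetric] N(3) by (auto simp: convex_hull_finite)
  define l where "l e = u (P e)" for e
  have l: "\<And>e. e \<in> N \<Longrightarrow> 0 \<le> l e" "sum l N = 1" "f = (\<Sum>e\<in>N. l e *\<^sub>R P e)"
    using u by (simp_all add: l_def sum.reindex[OF N(2)] o_def)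
  have f_nth: "f $ j $ i = (\<Sum>e\<in>{e\<in>N. sel e j = i}. l e)" for j i
    unfolding l(3) using finN by (simp add: P_def sum.inter_filter if_distrib cong: if_cong)
  have f_sum: "(\<Sum>i\<in>UNIV. f $ j $ i) = 1" for j
    unfolding f_nth using sum.group[of N UNIV "\<lambda>e. sel e j" l] finN l(2) by simp
  have x_pos: "0 < x $ j $ i" for j i
  proof (rule ccontr)
    assume "\<not> 0 < x $ j $ i"
    then have "empty_shift x j i"
      using x unfolding empty_shift_def day_partitions_iff by (metis antisym not_less)
    then have empty: "empty_shift x j (sel e j)" if "e \<in> N" for e
      using prefers_empty[of e] sel[of e] N(1) that unfolding prefers_empty_shifts_def by blast
    have "\<exists>m. x $ j $ m \<noteq> 0"
      using x unfolding day_partitions_iff by (metis sum.neutral zero_neq_one)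
    then obtain m where "x $ j $ m \<noteq> 0" by blast
    moreover from this have m: "0 < x $ j $ m"
      using x unfolding day_partitions_iff by (metis less_le)
    ultimately have "{e\<in>N. sel e j = m} = {}"
      using empty by (auto simp: empty_shift_def)
    then have "f $ j $ m = 0" unfolding f_nth by (simp only: sum.empty)
    then have "f $ j $ m' \<le> 0" for m'
      using variational_inequality_entries[OF x vi m] by metis
    then have "(\<Sum>m'\<in>UNIV. f $ j $ m') \<le> 0" by (intro sum_nonpos)
    with f_sum[of j] show False by simp
  qed
  have f_eq: "real CARD('n) * f $ j $ i = 1" for j i
  proof -
    have "f $ j $ m = f $ j $ i" for m
      using variational_inequality_entries[OF x vi x_pos] by (intro antisym)
    then have "(\<Sum>m\<in>UNIV. f $ j $ m) = (\<Sum>m\<in>(UNIV::'n set). f $ j $ i)" by (intro sum.cong) auto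
    with f_sum[of j] show ?thesis by simp
  qed
  have "(\<Sum>e\<in>{e\<in>N. sel e j = i}. real CARD('n) * l e) = 1" for j i
    using f_eq[of j i] by (simp add: f_nth sum_distrib_left)
  moreover have "\<forall>e\<in>N. x \<in> C e (sel e) \<and> 0 \<le> real CARD('n) * l e"
    using N(1) sel l(1) by auto
  ultimately show ?thesis
    using x N(1)
    by (intro bexI[of _ x] exI[of _ sel] exI[of _ N] exI[of _ "\<lambda>e. real CARD('n) * l e"]) simp_all
qed

section \<open>Covers from fractional covers\<close>

lemma harm_diff_ge:
  assumes "b \<le> a" "a \<le> r" "r > 0"
  shows "(real a - real b) / real r \<le> harm a - harm b"
  using assms(1,2)
proof (induction a rule: dec_induct)
  case base
  then show ?case by simp
next
  case (step a)
  have "1 / real r \<le> inverse (real (Suc a))"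
    using step.prems by (simp add: inverse_eq_divide frac_le)
  with step show ?case
    by (simp add: harm_Suc add_divide_distrib diff_divide_distrib)
qed

lemma harm_le_1_plus_ln:
  assumes "k > 0"
  shows "harm k \<le> 1 + ln (real k)"
proof -
  obtain m where m: "k = Suc m" using assms by (cases k) auto
  have "harm (Suc m) - ln (real (Suc m)) \<le> harm (Suc 0) - ln (real (Suc 0))"
    using decseq_harm_diff_ln by (rule decseqD) simp
  then show ?thesis by (simp add: m harm_Suc harm_def)
qed

text \<open>
  The greedy algorithm, analysed with the budget on the right-hand side: removing from \<open>U\<close> the
  points of an edge that covers the most points of \<open>U\<close> lowers the budget by at least 1, so the
  budget pays for that edge.
\<close>

lemma greedy_cover:
  fixes w :: "'e \<Rightarrow> real" and S :: "'e \<Rightarrow> 'v set"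
  assumes "finite U" and E: "finite E" "\<And>e. e \<in> E \<Longrightarrow> 0 \<le> w e"
    and "\<And>v. v \<in> U \<Longrightarrow> 1 \<le> (\<Sum>e\<in>{e\<in>E. v \<in> S e}. w e)"
  shows "\<exists>N\<subseteq>E. U \<subseteq> (\<Union>e\<in>N. S e) \<and> real (card N) \<le> (\<Sum>e\<in>E. w e * harm (card (S e \<inter> U)))"
  using assms(1,4)
proof (induction U rule: finite_psubset_induct)
  case (psubset U)
  show ?case
  proof (cases "U = {}")
    case True
    then show ?thesis by (intro exI[of _ "{}"]) (simp add: harm_def)
  next
    case False
    then obtain v where v: "v \<in> U" by auto
    have "\<exists>e\<in>E. v \<in> S e"
    proof (rule ccontr)
      assume "\<not> ?thesis"
      then have "{e\<in>E. v \<in> S e} = {}" by auto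
      then show False using psubset.prems[OF v] by (simp only:) simp
    qed
    then obtain e1 where e1: "e1 \<in> E" "v \<in> S e1" by auto
    define r where "r = Max ((\<lambda>e. card (S e \<inter> U)) ` E)"
    have "r \<in> (\<lambda>e. card (S e \<inter> U)) ` E"
      unfolding r_def using E(1) e1(1) by (intro Max_in) auto
    then obtain e0 where e0: "e0 \<in> E" "card (S e0 \<inter> U) = r" by auto
    have r_max: "card (S e \<inter> U) \<le> r" if "e \<in> E" for e
      unfolding r_def using E(1) that by (intro Max_ge) auto
    have "card (S e1 \<inter> U) > 0"
      using psubset.hyps v e1 by (auto simp: card_gt_0_iff)
    with r_max[OF e1(1)] have r_pos: "r > 0" by linarith
    define U' where "U' = U - S e0"
    have "S e0 \<inter> U \<noteq> {}" using r_pos e0 by (metis card.empty less_irrefl)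
    then have "U' \<subset> U" by (auto simp: U'_def)
    moreover have "1 \<le> (\<Sum>e\<in>{e\<in>E. v \<in> S e}. w e)" if "v \<in> U'" for v
      using psubset.prems that by (simp add: U'_def)
    ultimately obtain N where N: "N \<subseteq> E" "U' \<subseteq> (\<Union>e\<in>N. S e)"
      "real (card N) \<le> (\<Sum>e\<in>E. w e * harm (card (S e \<inter> U')))"
      using psubset.IH[of U'] by blast
    have split: "real (card (S e \<inter> U)) - real (card (S e \<inter> U')) = real (card (S e \<inter> (S e0 \<inter> U)))" for e
    proof -
      have "S e \<inter> U = (S e \<inter> U') \<union> (S e \<inter> (S e0 \<inter> U))" by (auto simp: U'_def)
      moreover have "card ((S e \<inter> U') \<union> (S e \<inter> (S e0 \<inter> U))) = card (S e \<inter> U') + card (S e \<inter> (S e0 \<inter> U))"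
        using psubset.hyps by (intro card_Un_disjoint) (auto simp: U'_def)
      ultimately show ?thesis by simp
    qed
    \<comment> \<open>Each of the \<open>r\<close> newly covered points carries weight at least 1, and the harmonic
      number of every edge drops by at least \<open>1/r\<close> for each newly covered point on it.\<close>
    have "1 = (\<Sum>v\<in>S e0 \<inter> U. 1) / real r"
      using e0(2) r_pos by simp
    also have "\<dots> \<le> (\<Sum>v\<in>S e0 \<inter> U. \<Sum>e\<in>{e\<in>E. v \<in> S e}. w e) / real r"
      using psubset.prems by (intro divide_right_mono sum_mono) auto
    also have "(\<Sum>v\<in>S e0 \<inter> U. \<Sum>e\<in>{e\<in>E. v \<in> S e}. w e)
        = (\<Sum>e\<in>E. \<Sum>v\<in>{v\<in>S e0 \<inter> U. v \<in> S e}. w e)"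
      using psubset.hyps E(1) by (intro sum.swap_restrict) auto
    also have "\<dots> = (\<Sum>e\<in>E. w e * real (card (S e \<inter> (S e0 \<inter> U))))"
    proof (rule sum.cong)
      fix e
      have "{v\<in>S e0 \<inter> U. v \<in> S e} = S e \<inter> (S e0 \<inter> U)" by auto
      then show "(\<Sum>v\<in>{v\<in>S e0 \<inter> U. v \<in> S e}. w e) = w e * real (card (S e \<inter> (S e0 \<inter> U)))"
        by simp
    qed simp
    also have "\<dots> / real r = (\<Sum>e\<in>E. w e * ((real (card (S e \<inter> U)) - real (card (S e \<inter> U'))) / real r))"
      by (simp add: split sum_divide_distrib)
    also have "\<dots> \<le> (\<Sum>e\<in>E. w e * (harm (card (S e \<inter> U)) - harm (card (S e \<inter> U'))))"
    proof (intro sum_mono mult_left_mono harm_diff_ge)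
      fix e assume "e \<in> E"
      show "card (S e \<inter> U') \<le> card (S e \<inter> U)"
        using psubset.hyps by (intro card_mono) (auto simp: U'_def)
    qed (use r_max r_pos E(2) in auto)
    finally have "1 + (\<Sum>e\<in>E. w e * harm (card (S e \<inter> U'))) \<le> (\<Sum>e\<in>E. w e * harm (card (S e \<inter> U)))"
      by (simp add: right_diff_distrib sum_subtractf)
    moreover have "real (card (insert e0 N)) \<le> 1 + real (card N)"
      using card_insert_le_m1[of "Suc (card N)" N e0] by simp
    ultimately show ?thesis
      using N e0(1) by (intro exI[of _ "insert e0 N"]) (auto simp: U'_def)
  qed
qed

text \<open>
  Hall's theorem, by Rado's argument: if some \<open>A i0\<close> has two elements \<open>x\<close> and \<open>y\<close>, then one of them
  can be deleted from it without violating Hall's condition. If both deletions failed, witnessed by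
  the index sets \<open>J\<close> and \<open>K\<close>, then Hall's condition for \<open>insert i0 (J \<union> K)\<close> and for \<open>J \<inter> K\<close> would
  contradict the modularity of cardinality. When no deletion is left, all \<open>A i\<close> are singletons.
\<close>

lemma hall_transversal:
  fixes A :: "'i \<Rightarrow> 'v set"
  assumes "finite I" "\<And>i. i \<in> I \<Longrightarrow> finite (A i)"
    and "\<And>J. J \<subseteq> I \<Longrightarrow> card J \<le> card (\<Union>i\<in>J. A i)"
  shows "\<exists>R. inj_on R I \<and> (\<forall>i\<in>I. R i \<in> A i)"
  using assms(2,3)
proof (induction "\<Sum>i\<in>I. card (A i)" arbitrary: A rule: less_induct)
  case less
  note fin = less.prems(1) and hall = less.prems(2)
  show ?case
  proof (cases "\<forall>i\<in>I. card (A i) \<le> 1")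
    case True
    have "\<exists>x. A i = {x}" if "i \<in> I" for i
    proof -
      have "card {i} \<le> card (\<Union>i\<in>{i}. A i)" using that by (intro hall) auto
      with True that have "card (A i) = 1" by fastforce
      then show ?thesis by (simp add: card_1_singleton_iff)
    qed
    then obtain R where R: "\<And>i. i \<in> I \<Longrightarrow> A i = {R i}" by metis
    have "inj_on R I"
    proof (rule inj_onI, rule ccontr)
      fix i j assume ij: "i \<in> I" "j \<in> I" "R i = R j" "i \<noteq> j"
      have "card {i, j} \<le> card (\<Union>i\<in>{i, j}. A i)" using ij by (intro hall) auto
      then show False using ij R by simp
    qed
    then show ?thesis using R by (intro exI[of _ R]) auto
  next
    case False
    then obtain i0 where i0: "i0 \<in> I" "2 \<le> card (A i0)" by force
    then obtain x y where xy: "x \<in> A i0" "y \<in> A i0" "x \<noteq> y"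
      by (metis card_le_Suc0_iff_eq fin not_less_eq_eq numeral_2_eq_2)
    have step: "\<exists>R. inj_on R I \<and> (\<forall>i\<in>I. R i \<in> A i)"
      if z: "z \<in> A i0"
        and hall': "\<And>J. J \<subseteq> I - {i0} \<Longrightarrow> Suc (card J) \<le> card ((\<Union>i\<in>J. A i) \<union> (A i0 - {z}))" for z
    proof -
      define B where "B = A(i0 := A i0 - {z})"
      have "(\<Sum>i\<in>I. card (B i)) < (\<Sum>i\<in>I. card (A i))"
      proof (rule sum_strict_mono_ex1)
        show "\<forall>i\<in>I. card (B i) \<le> card (A i)"
          by (auto simp: B_def fin intro!: card_mono)
        have "card (B i0) < card (A i0)"
          unfolding B_def fun_upd_same using fin[OF i0(1)] z by (rule card_Diff1_less)
        then show "\<exists>i\<in>I. card (B i) < card (A i)" using i0(1) by blast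
      qed (rule assms(1))
      moreover have "finite (B i)" if "i \<in> I" for i
        using fin that by (auto simp: B_def)
      moreover have "card J \<le> card (\<Union>i\<in>J. B i)" if J: "J \<subseteq> I" for J
      proof (cases "i0 \<in> J")
        case True
        have "(\<Union>i\<in>J. B i) = (\<Union>i\<in>J - {i0}. A i) \<union> (A i0 - {z})"
          using True by (auto simp: B_def split: if_splits)
        moreover have "Suc (card (J - {i0})) = card J"
          using True J assms(1) by (metis card_Suc_Diff1 finite_subset)
        ultimately show ?thesis using hall'[of "J - {i0}"] J by auto
      next
        case False
        then have "(\<Union>i\<in>J. B i) = (\<Union>i\<in>J. A i)"
          by (auto simp: B_def split: if_splits)
        then show ?thesis using hall[OF J] by simp
      qed
      ultimately obtain R where "inj_on R I" "\<forall>i\<in>I. R i \<in> B i"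
        using less.hyps[of B] by blast
      then show ?thesis
        by (intro exI[of _ R]) (auto simp: B_def split: if_splits)
    qed
    show ?thesis
    proof (rule ccontr)
      assume no: "\<not> ?thesis"
      obtain J where J: "J \<subseteq> I - {i0}" "card ((\<Union>i\<in>J. A i) \<union> (A i0 - {x})) \<le> card J"
        using step[OF xy(1)] no by (metis not_less_eq_eq)
      obtain K where K: "K \<subseteq> I - {i0}" "card ((\<Union>i\<in>K. A i) \<union> (A i0 - {y})) \<le> card K"
        using step[OF xy(2)] no by (metis not_less_eq_eq)
      define X where "X = (\<Union>i\<in>J. A i) \<union> (A i0 - {x})"
      define Y where "Y = (\<Union>i\<in>K. A i) \<union> (A i0 - {y})"
      have finJK: "finite J" "finite K"
        using J K assms(1) by (meson finite_Diff finite_subset)+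
      have finXY: "finite X" "finite Y"
        using J K finJK fin i0 by (auto simp: X_def Y_def)
      have "card (insert i0 (J \<union> K)) \<le> card (\<Union>i\<in>insert i0 (J \<union> K). A i)"
        using J K i0 by (intro hall) auto
      also have "(\<Union>i\<in>insert i0 (J \<union> K). A i) = X \<union> Y"
        using xy by (auto simp: X_def Y_def)
      finally have union: "Suc (card (J \<union> K)) \<le> card (X \<union> Y)"
        using J K finJK by (subst (asm) card_insert_disjoint) auto
      have "card (J \<inter> K) \<le> card (\<Union>i\<in>J \<inter> K. A i)"
        using J K by (intro hall) auto
      also have "\<dots> \<le> card (X \<inter> Y)"
        using finXY by (intro card_mono) (auto simp: X_def Y_def)
      finally have inter: "card (J \<inter> K) \<le> card (X \<inter> Y)" .
      have "card (X \<union> Y) + card (X \<inter> Y) = card X + card Y"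
        "card (J \<union> K) + card (J \<inter> K) = card J + card K"
        using card_Un_Int finXY finJK by metis+
      with union inter J(2) K(2) show False
        unfolding X_def[symmetric] Y_def[symmetric] by linarith
    qed
  qed
qed

text \<open>Here \<open>a\<close> and \<open>b\<close> are the two ends of an edge of a bipartite multigraph, and \<open>w\<close> is a
  fractional perfect matching. The edges leaving \<open>J\<close> have total weight \<open>card J\<close> and end in the
  neighbourhood of \<open>J\<close>, which can absorb no more than its own cardinality; this is Hall's condition.\<close>

lemma perfect_matching_of_fractional:
  fixes w :: "'e \<Rightarrow> real" and a b :: "'e \<Rightarrow> 'n::finite"
  assumes E: "finite E" "\<And>e. e \<in> E \<Longrightarrow> 0 \<le> w e"
    and a: "\<And>i. (\<Sum>e\<in>{e\<in>E. a e = i}. w e) = 1"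
    and b: "\<And>i. (\<Sum>e\<in>{e\<in>E. b e = i}. w e) = 1"
  shows "\<exists>N\<subseteq>E. bij_betw a N UNIV \<and> bij_betw b N UNIV"
proof -
  define A where "A i = b ` {e\<in>E. a e = i}" for i
  have "card J \<le> card (\<Union>i\<in>J. A i)" for J
  proof -
    have 1: "(\<Sum>e\<in>{e\<in>E. c e \<in> J}. w e) = real (card J)"
      if "\<And>i. (\<Sum>e\<in>{e\<in>E. c e = i}. w e) = 1" for c :: "'e \<Rightarrow> 'n" and J
    proof -
      have "(\<Sum>e\<in>{e\<in>E. c e \<in> J}. w e) = (\<Sum>i\<in>J. \<Sum>e\<in>{e\<in>{e\<in>E. c e \<in> J}. c e = i}. w e)"
        using E(1) by (intro sum.group[symmetric]) auto
      also have "\<dots> = (\<Sum>i\<in>J. \<Sum>e\<in>{e\<in>E. c e = i}. w e)"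
        by (intro sum.cong refl) auto
      finally show ?thesis using that by simp
    qed
    have "real (card J) = (\<Sum>e\<in>{e\<in>E. a e \<in> J}. w e)"
      using 1[of a J] a by simp
    also have "\<dots> \<le> (\<Sum>e\<in>{e\<in>E. b e \<in> (\<Union>i\<in>J. A i)}. w e)"
      using E by (intro sum_mono2) (auto simp: A_def)
    also have "\<dots> = real (card (\<Union>i\<in>J. A i))"
      by (rule 1[of b, OF b])
    finally show ?thesis by simp
  qed
  then obtain R where R: "inj R" "\<And>i. R i \<in> A i"
    using hall_transversal[of UNIV A] by auto
  then have "\<forall>i. \<exists>e\<in>E. a e = i \<and> b e = R i"
    by (auto simp: A_def image_iff) metis
  then obtain g where g: "\<And>i. g i \<in> E" "\<And>i. a (g i) = i" "\<And>i. b (g i) = R i" by metis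
  have "bij R" using R(1) by (simp add: bij_betw_def finite_UNIV_inj_surj)
  moreover have "bij_betw g UNIV (range g)"
    using g(2) by (intro bij_betw_imageI inj_on_inverseI[of _ a]) auto
  ultimately have "bij_betw a (range g) UNIV" "bij_betw b (range g) UNIV"
    using g by (auto simp: bij_betw_def inj_on_def image_image)
  then show ?thesis using g(1) by (intro exI[of _ "range g"]) auto
qed

section \<open>Covering all shifts\<close>

theorem theorem1p3:
  fixes C :: "'e \<Rightarrow> ('n::finite, 'k::finite) preferences"
    and E :: "'e set"
    and n k p :: nat
  assumes n: "n = CARD('n)"
    and k: "k = CARD('k)"
    and employees: "finite E" "card E = p" "p \<ge> k * (n - 1) + 1"
    and preference_sets: "\<And>e s. e \<in> E \<Longrightarrow> C e s \<subseteq> day_partitions"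
    and accepts: "\<And>e. e \<in> E \<Longrightarrow> always_accepts_some (C e)"
    and prefers_empty: "\<And>e. e \<in> E \<Longrightarrow> prefers_empty_shifts (C e)"
    and indifferent: "\<And>e. e \<in> E \<Longrightarrow> indifferent_between_empty_shifts (C e)"
    and closed_preferences: "\<And>e s. e \<in> E \<Longrightarrow> closed (C e s)"
  shows "(\<exists>x\<in>day_partitions. \<exists>N\<subseteq>E.
            real (card N) \<le> real n * (1 + ln (real k)) \<and> covers_all_shifts C N x) \<and>
         (k = 2 \<longrightarrow> (\<exists>x\<in>day_partitions. \<exists>N\<subseteq>E. card N = n \<and> covers_all_shifts C N x))"
proof -
  have "CARD('k) * (CARD('n) - 1) + 1 \<le> card E" using employees n k by simp
  then obtain E' where E': "E' \<subseteq> E" "card E' = CARD('k) * (CARD('n) - 1) + 1" "finite E'"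
    by (rule obtain_subset_with_card_n)
  have "\<exists>x\<in>day_partitions. \<exists>sel N w. N \<subseteq> E' \<and> (\<forall>e\<in>N. x \<in> C e (sel e) \<and> 0 \<le> w e) \<and>
      (\<forall>j i. (\<Sum>e\<in>{e\<in>N. sel e j = i}. w e) = (1::real))"
    using E'(1) accepts prefers_empty closed_preferences
    by (intro fractionally_covered_partition E'(3,2)) auto
  then obtain x sel N w where x: "x \<in> day_partitions" and N: "N \<subseteq> E'"
    and sel_w0: "\<forall>e\<in>N. x \<in> C e (sel e) \<and> 0 \<le> w e"
    and w_all: "\<forall>j i. (\<Sum>e\<in>{e\<in>N. sel e j = i}. w e) = (1::real)"
    by (elim bexE exE conjE) (rule that, assumption+)
  have w: "(\<Sum>e\<in>{e\<in>N. sel e j = i}. w e) = 1" for j i using w_all by simp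
  have sel: "x \<in> C e (sel e)" and w0: "0 \<le> w e" if "e \<in> N" for e
    using sel_w0 that by simp_all
  have finN: "finite N" using N E'(3) finite_subset by blast
  have w_total: "sum w N = real n"
  proof -
    fix j :: 'k
    have "sum w N = (\<Sum>i\<in>UNIV. \<Sum>e\<in>{e\<in>N. sel e j = i}. w e)"
      using finN by (intro sum.group[symmetric]) auto
    then show ?thesis using w n by simp
  qed
  have covers: "covers_all_shifts C M x" if "M \<subseteq> N" "\<And>i j. \<exists>e\<in>M. sel e j = i" for M
    unfolding covers_all_shifts_def using that sel by (intro exI[of _ sel]) blast
  have "\<exists>M\<subseteq>E. real (card M) \<le> real n * (1 + ln (real k)) \<and> covers_all_shifts C M x"
  proof -
    define S where "S e = {(j, i). sel e j = i}" for e
    have card_S: "card (S e) = k" for e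
    proof -
      have "S e = (\<lambda>j. (j, sel e j)) ` UNIV" by (auto simp: S_def)
      then show ?thesis using k by (simp add: card_image inj_on_def)
    qed
    have "1 \<le> (\<Sum>e\<in>{e\<in>N. p \<in> S e}. w e)" for p
      using w[of "fst p" "snd p"] by (simp add: S_def case_prod_beta)
    then have "\<exists>M\<subseteq>N. UNIV \<subseteq> (\<Union>e\<in>M. S e) \<and>
        real (card M) \<le> (\<Sum>e\<in>N. w e * harm (card (S e \<inter> UNIV)))"
      using finN w0 by (intro greedy_cover) auto
    then obtain M where M: "M \<subseteq> N" "UNIV \<subseteq> (\<Union>e\<in>M. S e)"
        "real (card M) \<le> (\<Sum>e\<in>N. w e * harm (card (S e \<inter> UNIV)))"
      by blast
    note M(3)
    also have "(\<Sum>e\<in>N. w e * harm (card (S e \<inter> UNIV))) = real n * harm k"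
      using card_S w_total by (simp flip: sum_distrib_right)
    also have "\<dots> \<le> real n * (1 + ln (real k))"
      using harm_le_1_plus_ln[of k] k by (intro mult_left_mono) auto
    finally have "real (card M) \<le> real n * (1 + ln (real k))" .
    moreover have "\<exists>e\<in>M. sel e j = i" for i j
    proof -
      have "(j, i) \<in> (\<Union>e\<in>M. S e)" using M(2) by blast
      then show ?thesis by (auto simp: S_def)
    qed
    then have "covers_all_shifts C M x" by (rule covers[OF M(1)])
    ultimately show ?thesis using M(1) N E'(1) by blast
  qed
  moreover have "\<exists>M\<subseteq>E. card M = n \<and> covers_all_shifts C M x" if "k = 2"
  proof -
    have "CARD('k) = 2" using that k by simp
    then obtain j1 j2 :: 'k where j: "UNIV = {j1, j2}"
      by (auto simp: card_2_iff)
    have "\<exists>M\<subseteq>N. bij_betw (\<lambda>e. sel e j1) M UNIV \<and> bij_betw (\<lambda>e. sel e j2) M UNIV"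
      by (rule perfect_matching_of_fractional[where w = w]) (simp_all add: finN w0 w)
    then obtain M where M: "M \<subseteq> N" "bij_betw (\<lambda>e. sel e j1) M UNIV" "bij_betw (\<lambda>e. sel e j2) M UNIV"
      by blast
    have "\<exists>e\<in>M. sel e j = i" for i j
    proof -
      have "i \<in> (\<lambda>e. sel e j1) ` M" "i \<in> (\<lambda>e. sel e j2) ` M"
        using M(2,3) by (simp_all add: bij_betw_def)
      moreover have "j = j1 \<or> j = j2" using j by auto
      ultimately show ?thesis by auto
    qed
    then have "covers_all_shifts C M x" by (rule covers[OF M(1)])
    moreover have "card M = n" using bij_betw_same_card[OF M(2)] n by simp
    ultimately show ?thesis using M(1) N E'(1) by blast
  qed
  ultimately show ?thesis using x by blast
qed

end
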